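(* Assume the continuum hypothesis. Let $X$ be a Polish topological vector space (over $\mathbb{R}$), and let $(X,\mathcal{C})$ be a perfect translation base which satisfies the countable chain condition, where $\mathcal{C}$ is linearly invariant and $\operatorname{card}(\mathcal{C})\le 2^{\aleph_0}$. Then there exist two sets $T,T'\subseteq X$ such that (i) both $T$ and $T'$ are rare sets in $(X,\mathcal{C})$; (ii) their sum $T+T'=\{a+b:a\in T,\ b\in T'\}$ is a Bernstein set in $X$; (iii) $T$ and $T'$ are both meager in every perfect translation base $(X,\mathcal{D})$ that is non-equivalent to $(X,\mathcal{C})$.
   Context: A category base is a pair $(X,\mathcal{C})$ with $X$ a nonempty set and $\mathcal{C}$ a family of subsets of $X$ whose nonempty members (called regions) satisfy: (1) $X=\bigcup\mathcal{C}$; (2) for every region $A$ and every nonempty family $\mathcal{D}$ of pairwise disjoint regions with $\operatorname{card}(\mathcal{D})<\operatorname{card}(\mathcal{C})$: (i) if $A\cap\bigcup\mathcal{D}$ contains a region, then there is $D\in\mathcal{D}$ such that $A\cap D$ contains a region; (ii) if $A\cap\bigcup\mathcal{D}$ contains no region, then there is a region $B\subseteq A$ disjoint from every region in $\mathcal{D}$. A set $S\subseteq X$ is singular if every region contains a subregion disjoint from $S$; a set is meager if it is a countable union of singular sets, and abundant otherwise. A set $E$ is a Baire set if every region contains a subregion in which $E$ or its complement is meager (i.e. whose intersection with $E$, resp. with $X\setminus E$, is meager). Let $\mathcal{M}(\mathcal{C})$ and $\mathcal{B}(\mathcal{C})$ be the classes of meager and Baire sets. Two category bases $(X,\mathcal{C})$,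 $(X,\mathcal{D})$ are equivalent if $\mathcal{M}(\mathcal{C})=\mathcal{M}(\mathcal{D})$ and $\mathcal{B}(\mathcal{C})=\mathcal{B}(\mathcal{D})$. A perfect base on $X$ is a category base in which every region is a perfect subset of $X$ and, for every region $A$ and every $x\in A$, there is a descending sequence $A_1\supseteq A_2\supseteq\cdots$ of regions with $x\in A_n$ and $\operatorname{diam}(A_n)\le 1/n$ (w.r.t. a compatible complete metric). A perfect translation base is a perfect base $(X,\mathcal{C})$ such that $\mathcal{C}$ is translation invariant ($E\in\mathcal{C}$, $r\in X$ imply $E+r\in\mathcal{C}$) and, for every region $A$ and every countable dense set $D\subseteq X$, the set $\bigcup_{r\in D}(A+r)$ is abundant everywhere (its intersection with every region is abundant). The base satisfies the countable chain condition if every family of pairwise disjoint regions is at most countable. $\mathcal{C}$ is linearly invariant if it is translation invariant and $\lambda E\in\mathcal{C}$ for every $E\in\mathcal{C}$ and every nonzero scalar $\lambda$. A set $R$ is rare in $(X,\mathcal{C})$ if $R$ is uncountable and $R\cap M$ is countable for every meager set $M$ of $(X,\mathcal{C})$. A Bernstein set in $X$ is a set $B\subseteq X$ such that $B\cap P\neq\emptyset$ and $(X\setminus B)\cap P\neq\emptyset$ for every nonempty perfect set $P\subseteq X$. *)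

theory Defs
  imports "HOL-Analysis.Analysis" "HOL-Library.Equipollence"
begin

definition region :: "'a set set \<Rightarrow> 'a set \<Rightarrow> bool" where
  "region C A \<longleftrightarrow> A \<in> C \<and> A \<noteq> {}"

definition category_base :: "'a set set \<Rightarrow> bool" where
  "category_base C \<longleftrightarrow>
     \<Union>C = UNIV \<and>
     (\<forall>A D. region C A \<and> D \<noteq> {} \<and> (\<forall>E\<in>D. region C E) \<and> pairwise disjnt D \<and> D \<prec> C \<longrightarrow>
        ((\<exists>R. region C R \<and> R \<subseteq> A \<inter> \<Union>D) \<longrightarrow>
            (\<exists>E\<in>D. \<exists>R. region C R \<and> R \<subseteq> A \<inter> E)) \<and>
        (\<not> (\<exists>R. region C R \<and> R \<subseteq> A \<inter> \<Union>D) \<longrightarrow>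
            (\<exists>B. region C B \<and> B \<subseteq> A \<and> (\<forall>E\<in>D. B \<inter> E = {}))))"

definition singular :: "'a set set \<Rightarrow> 'a set \<Rightarrow> bool" where
  "singular C S \<longleftrightarrow> (\<forall>A. region C A \<longrightarrow> (\<exists>B. region C B \<and> B \<subseteq> A \<and> B \<inter> S = {}))"

definition meager :: "'a set set \<Rightarrow> 'a set \<Rightarrow> bool" where
  "meager C S \<longleftrightarrow> (\<exists>F. countable F \<and> (\<forall>T\<in>F. singular C T) \<and> S = \<Union>F)"

definition abundant :: "'a set set \<Rightarrow> 'a set \<Rightarrow> bool" where
  "abundant C S \<longleftrightarrow> \<not> meager C S"

definition baire_set :: "'a set set \<Rightarrow> 'a set \<Rightarrow> bool" where
  "baire_set C E \<longleftrightarrow> (\<forall>A. region C A \<longrightarrow>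
     (\<exists>B. region C B \<and> B \<subseteq> A \<and> (meager C (B \<inter> E) \<or> meager C (B \<inter> (UNIV - E)))))"

definition equivalent_bases :: "'a set set \<Rightarrow> 'a set set \<Rightarrow> bool" where
  "equivalent_bases C D \<longleftrightarrow>
     {S. meager C S} = {S. meager D S} \<and> {E. baire_set C E} = {E. baire_set D E}"

definition perfect_set :: "'a::topological_space set \<Rightarrow> bool" where
  "perfect_set P \<longleftrightarrow> closed P \<and> (\<forall>x\<in>P. x islimpt P)"

definition perfect_base :: "'a::metric_space set set \<Rightarrow> bool" where
  "perfect_base C \<longleftrightarrow> category_base C \<and>
     (\<forall>A. region C A \<longrightarrow> perfect_set A) \<and>
     (\<forall>A x. region C A \<and> x \<in> A \<longrightarrow>
        (\<exists>S::nat \<Rightarrow> 'a set. decseq S \<and>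
           (\<forall>n. region C (S n) \<and> x \<in> S n \<and> bounded (S n) \<and>
                diameter (S n) \<le> 1 / real (Suc n))))"

definition translation_invariant :: "'a::plus set set \<Rightarrow> bool" where
  "translation_invariant C \<longleftrightarrow> (\<forall>E\<in>C. \<forall>r. (\<lambda>x. x + r) ` E \<in> C)"

definition abundant_everywhere :: "'a set set \<Rightarrow> 'a set \<Rightarrow> bool" where
  "abundant_everywhere C S \<longleftrightarrow> (\<forall>A. region C A \<longrightarrow> abundant C (S \<inter> A))"

definition perfect_translation_base :: "'a::{metric_space, plus} set set \<Rightarrow> bool" where
  "perfect_translation_base C \<longleftrightarrow> perfect_base C \<and> translation_invariant C \<and>
     (\<forall>A D. region C A \<and> countable D \<and> closure D = UNIV \<longrightarrow>
        abundant_everywhere C (\<Union>r\<in>D. (\<lambda>x. x + r) ` A))"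

definition ccc_base :: "'a set set \<Rightarrow> bool" where
  "ccc_base C \<longleftrightarrow> (\<forall>F. (\<forall>A\<in>F. region C A) \<and> pairwise disjnt F \<longrightarrow> countable F)"

definition linearly_invariant :: "'a::real_vector set set \<Rightarrow> bool" where
  "linearly_invariant C \<longleftrightarrow> translation_invariant C \<and>
     (\<forall>E\<in>C. \<forall>c::real. c \<noteq> 0 \<longrightarrow> (\<lambda>x. c *\<^sub>R x) ` E \<in> C)"

definition rare_set :: "'a set set \<Rightarrow> 'a set \<Rightarrow> bool" where
  "rare_set C R \<longleftrightarrow> uncountable R \<and> (\<forall>M. meager C M \<longrightarrow> countable (R \<inter> M))"

definition bernstein_set :: "'a::topological_space set \<Rightarrow> bool" where
  "bernstein_set B \<longleftrightarrow> (\<forall>P. P \<noteq> {} \<and> perfect_set P \<longrightarrow> B \<inter> P \<noteq> {} \<and> (UNIV - B) \<inter> P \<noteq> {})"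

definition continuum_hypothesis :: bool where
  "continuum_hypothesis \<longleftrightarrow> (\<forall>S::real set. uncountable S \<longrightarrow> S \<approx> (UNIV::real set))"

end

theory Submission
  imports Defs
begin

text \<open>Any rare set is meager in every perfect translation base \<open>D\<close> non-equivalent to \<open>C\<close>, because
  the space is the union of a \<open>C\<close>-meager and a \<open>D\<close>-meager set. By the countable chain condition, every
  \<open>C\<close>-meager set lies in a Borel one; if the latter is \<open>D\<close>-abundant, its translates by a countable
  dense set fill the space up to a \<open>D\<close>-meager set, while their union stays \<open>C\<close>-meager. If this never
  happens, every \<open>C\<close>-meager set is \<open>D\<close>-meager, so \<open>D\<close> inherits the chain condition; then the roles
  can be exchanged and the two bases turn out to be equivalent.

  The sets \<open>T\<close> and \<open>T'\<close> come from a recursion of length \<open>\<omega>\<^sub>1\<close>. For each perfect set \<open>P\<close>, fix a point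
  of \<open>P\<close> to be omitted and another point \<open>p \<in> P\<close> to be represented as \<open>t + (p - t)\<close>; all
  requirements on \<open>t\<close> exclude only a meager set, as \<open>x \<mapsto> p - x\<close> preserves meagerness.\<close>

section \<open>Singular and meager sets\<close>

lemma singular_subset: "singular C S \<Longrightarrow> S' \<subseteq> S \<Longrightarrow> singular C S'"
  unfolding singular_def by (meson disjoint_iff subset_iff)

text \<open>Cutting the members of a countable cover by singular sets down to their traces on
  \<open>S\<close> turns the cover into an exact union.\<close>

lemma meager_iff: "meager C S \<longleftrightarrow> (\<exists>F. countable F \<and> (\<forall>T\<in>F. singular C T) \<and> S \<subseteq> \<Union>F)"
proof
  assume "\<exists>F. countable F \<and> (\<forall>T\<in>F. singular C T) \<and> S \<subseteq> \<Union>F"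
  then obtain F where F: "countable F" "\<And>T. T \<in> F \<Longrightarrow> singular C T" "S \<subseteq> \<Union>F"
    by blast
  have "S = \<Union>((\<inter>) S ` F)"
    using F(3) by blast
  moreover have "\<forall>T\<in>(\<inter>) S ` F. singular C T"
    using F(2) singular_subset by blast
  ultimately show "meager C S"
    unfolding meager_def using F(1) by blast
qed (auto simp: meager_def)

lemma meager_subset: "meager C S \<Longrightarrow> S' \<subseteq> S \<Longrightarrow> meager C S'"
  unfolding meager_iff by (meson order_trans)

lemma singular_meager: "singular C S \<Longrightarrow> meager C S"
  unfolding meager_iff by (rule exI[of _ "{S}"]) auto

lemma meager_empty [simp]: "meager C {}"
  unfolding meager_iff by (rule exI[of _ "{}"]) auto

lemma meager_Union:
  assumes "countable I" "\<And>i. i \<in> I \<Longrightarrow> meager C (S i)"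
  shows "meager C (\<Union>i\<in>I. S i)"
proof -
  obtain F where F: "\<And>i. i \<in> I \<Longrightarrow> countable (F i) \<and> (\<forall>T\<in>F i. singular C T) \<and> S i \<subseteq> \<Union>(F i)"
    using assms(2) unfolding meager_iff by metis
  then show ?thesis
    unfolding meager_iff using assms(1) by (intro exI[of _ "\<Union>i\<in>I. F i"]) fastforce
qed

lemma meager_Un: "meager C S \<Longrightarrow> meager C T \<Longrightarrow> meager C (S \<union> T)"
  using meager_Union[of "{S, T}" C "\<lambda>x. x"] by auto

lemma singular_empty [simp]: "singular C {}"
  unfolding singular_def by auto

lemma meager_sequence:
  assumes "meager C S"
  obtains T :: "nat \<Rightarrow> 'a set" where "\<And>n. singular C (T n)" "S = (\<Union>n. T n)"
proof -
  obtain F where F: "countable F" "\<And>T. T \<in> F \<Longrightarrow> singular C T" "S = \<Union>F"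
    using assms unfolding meager_def by blast
  \<comment> \<open>\<open>from_nat_into\<close> enumerates nonempty sets only; the inserted
    \<open>{}\<close> takes care of an empty \<open>F\<close> and is itself singular.\<close>
  define T where "T = from_nat_into (insert {} F)"
  have T: "range T = insert {} F"
    unfolding T_def using F(1) by (simp add: range_from_nat_into)
  then have "singular C (T n)" for n
    using F(2) by (metis insertE rangeI singular_empty)
  moreover have "S = (\<Union>n. T n)"
    unfolding F(3) T by simp
  ultimately show thesis
    by (rule that)
qed

text \<open>Such an \<open>f\<close> is an automorphism of the base: a region is pulled back by
  \<open>g\<close>, shrunk there to avoid the singular set, and pushed forward by
  \<open>f\<close>.\<close>

lemma meager_image:
  assumes fg: "\<And>x. f (g x) = x" "\<And>x. g (f x) = x"
    and f: "\<And>E. E \<in> C \<Longrightarrow> f ` E \<in> C" and g: "\<And>E. E \<in> C \<Longrightarrow> g ` E \<in> C"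
    and S: "meager C S"
  shows "meager C (f ` S)"
proof -
  have sing: "singular C (f ` T)" if T: "singular C T" for T
    unfolding singular_def
  proof (intro allI impI)
    fix A assume "region C A"
    then have "region C (g ` A)"
      using g by (auto simp: region_def)
    then obtain B where B: "region C B" "B \<subseteq> g ` A" "B \<inter> T = {}"
      using T unfolding singular_def by blast
    have "f ` B \<inter> f ` T = {}"
      using B(3) image_Int[of f B T] inj_on_inverseI[of UNIV g f] fg(2) by simp
    moreover have "f ` B \<subseteq> f ` g ` A"
      using B(2) by (rule image_mono)
    moreover have "f ` g ` A = A"
      by (simp add: image_image fg(1))
    moreover have "region C (f ` B)"
      using B(1) f by (auto simp: region_def)
    ultimately show "\<exists>B. region C B \<and> B \<subseteq> A \<and> B \<inter> f ` T = {}"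
      by metis
  qed
  obtain F where F: "countable F" "\<forall>T\<in>F. singular C T" "S \<subseteq> \<Union>F"
    using S unfolding meager_iff by blast
  then have "f ` S \<subseteq> \<Union>((`) f ` F)" by blast
  then show ?thesis
    unfolding meager_iff using F sing by (intro exI[of _ "(`) f ` F"]) auto
qed

section \<open>Perfect sets and enumerations by the reals\<close>

text \<open>Otherwise the sets \<open>P - {x}\<close> would be countably many dense open subsets of
  the completely metrizable space \<open>P\<close> with empty intersection, against the Baire
  category theorem.\<close>

lemma uncountable_perfect_set:
  fixes P :: "'a::polish_space set"
  assumes "perfect_set P" "P \<noteq> {}"
  shows "uncountable P"
proof
  assume c: "countable P"
  let ?X = "top_of_set P"
  have "completely_metrizable_space ?X"
    by (rule completely_metrizable_space_closedin[OF completely_metrizable_space_euclidean])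
      (use assms(1) in \<open>simp add: perfect_set_def\<close>)
  moreover have "openin ?X (P - {x}) \<and> ?X closure_of (P - {x}) = topspace ?X" if "x \<in> P" for x
  proof
    show "openin ?X (P - {x})"
      using openin_open_Int[of "- {x}" P] open_Compl[OF closed_singleton[of x]]
      by (simp add: Diff_eq)
    have "x \<in> closure (P - {x})"
      using assms(1) that unfolding perfect_set_def by (simp add: islimpt_in_closure)
    then have "P \<subseteq> closure (P - {x})"
      using closure_subset[of "P - {x}"] by blast
    moreover have "P \<inter> (P - {x}) = P - {x}"
      by blast
    ultimately show "?X closure_of (P - {x}) = topspace ?X"
      by (auto simp: closure_of_subtopology)
  qed
  ultimately have "?X closure_of \<Inter>((\<lambda>x. P - {x}) ` P) = topspace ?X"
    using c by (intro Baire_category) auto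
  moreover have "\<Inter>((\<lambda>x. P - {x}) ` P) = {}"
    using assms(2) by auto
  ultimately show False
    using assms(2) by simp
qed

text \<open>\<open>card_of UNIV\<close> is a well-order of least possible type, so its proper
  initial segments are smaller than the continuum, hence countable under the hypothesis.\<close>

lemma CH_well_order:
  assumes continuum_hypothesis
  shows "\<exists>R :: real rel. wf R \<and> trans R \<and> (\<forall>x y. x \<noteq> y \<longrightarrow> (x, y) \<in> R \<or> (y, x) \<in> R) \<and>
    (\<forall>x. countable {y. (y, x) \<in> R})"
proof -
  let ?r = "card_of (UNIV :: real set)"
  have wo: "well_order_on UNIV ?r"
    by (rule card_of_well_order_on)
  have "countable {y. (y, x) \<in> ?r - Id}" for x
  proof (rule ccontr)
    assume "uncountable {y. (y, x) \<in> ?r - Id}"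
    then have "{y. (y, x) \<in> ?r - Id} \<approx> (UNIV :: real set)"
      using assms unfolding continuum_hypothesis_def by blast
    moreover have "{y. (y, x) \<in> ?r - Id} = underS ?r x"
      by (auto simp: underS_def)
    ultimately have "ordIso2 (card_of (underS ?r x)) ?r"
      by (simp add: eqpoll_iff_card_of_ordIso)
    moreover have "ordLess2 (card_of (underS ?r x)) ?r"
      by (rule card_of_underS[OF card_of_Card_order]) (simp add: Field_card_of)
    ultimately show False
      using not_ordLess_ordIso by blast
  qed
  moreover have "wf (?r - Id)"
    using wo by (simp add: well_order_on_def)
  moreover have "trans (?r - Id)"
    using wo by (intro trans_diff_Id) (simp_all add: well_order_on_def linear_order_on_def
        partial_order_on_def preorder_on_def)
  moreover have "(x, y) \<in> ?r - Id \<or> (y, x) \<in> ?r - Id" if "x \<noteq> y" for x y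
    using wo that by (auto simp: well_order_on_def linear_order_on_def total_on_def)
  ultimately show ?thesis
    by (intro exI[of _ "?r - Id"]) simp
qed

lemma real_enumerates_nat_sets: "\<exists>e :: real \<Rightarrow> nat set. surj e"
  using nat_sets_eqpoll_reals by (metis eqpoll_def bij_betw_def bij_betw_inv)

text \<open>With a countable basis \<open>b\<close>, a sequence of closed sets is coded by the pairs
  \<open>(n, m)\<close> such that \<open>b m\<close> belongs to a chosen union for the complement of
  \<open>F n\<close>. Through \<open>prod_encode\<close> this is a set of naturals, and the reals
  enumerate those.\<close>

lemma real_enumerates_closed_sequences:
  "\<exists>G :: real \<Rightarrow> nat \<Rightarrow> 'a::second_countable_topology set. \<forall>F. (\<forall>n. closed (F n)) \<longrightarrow> (\<exists>x. G x = F)"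
proof -
  obtain e :: "real \<Rightarrow> nat set" where e: "surj e"
    using real_enumerates_nat_sets by blast
  obtain \<B> :: "'a set set" where \<B>: "countable \<B>" "topological_basis \<B>"
    using ex_countable_basis by blast
  define b where "b = from_nat_into (insert {} \<B>)"
  have b: "range b = insert {} \<B>"
    unfolding b_def using \<B>(1) by (simp add: range_from_nat_into)
  define G where "G x n = - (\<Union>m\<in>{m. prod_encode (n, m) \<in> e x}. b m)" for x n
  have "\<exists>x. G x = F" if F: "\<And>n. closed (F n)" for F
  proof -
    have "\<exists>N. F n = - (\<Union>m\<in>N. b m)" for n
    proof -
      obtain \<U> where "\<U> \<subseteq> \<B>" "\<Union>\<U> = - F n"
        using \<B>(2) F[of n] unfolding topological_basis_def by (metis open_Compl)
      then have "\<U> \<subseteq> range b" "F n = - \<Union>\<U>"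
        using b by auto
      then show ?thesis
        by (metis subset_image_iff)
    qed
    then obtain N where N: "\<And>n. F n = - (\<Union>m\<in>N n. b m)"
      by metis
    obtain x where "e x = prod_encode ` (SIGMA n:UNIV. N n)"
      using e by (metis surj_def)
    then have "{m. prod_encode (n, m) \<in> e x} = N n" for n
      by (auto simp: inj_image_mem_iff inj_prod_encode)
    then show ?thesis
      unfolding G_def using N by (intro exI[of _ x]) auto
  qed
  then show ?thesis by blast
qed

lemma real_enumerates_closed_sets:
  obtains g :: "real \<Rightarrow> 'a::second_countable_topology set" where "\<And>F. closed F \<Longrightarrow> \<exists>x. g x = F"
proof -
  obtain G :: "real \<Rightarrow> nat \<Rightarrow> 'a set" where G: "\<And>F. (\<And>n. closed (F n)) \<Longrightarrow> \<exists>x. G x = F"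
    using real_enumerates_closed_sequences by blast
  have "\<exists>x. G x 0 = F" if "closed F" for F
    using G[of "\<lambda>_. F"] that by (metis (full_types))
  then show thesis
    by (rule that[of "\<lambda>x. G x 0"])
qed

text \<open>Pigeonhole: \<open>\<lfloor>t / e\<rfloor>\<close> takes only countably many values, so
  two points of \<open>F\<close> share one.\<close>

lemma uncountable_reals_close:
  assumes "uncountable (F :: real set)" "e > 0"
  obtains s t where "s \<in> F" "t \<in> F" "s < t" "t - s < e"
proof -
  let ?h = "\<lambda>t. \<lfloor>t / e\<rfloor>"
  have "\<not> inj_on ?h F"
    using assms(1) countableI_type countable_image_inj_eq countable_subset by blast
  then obtain s t where st: "s \<in> F" "t \<in> F" "s < t" "?h s = ?h t"
    unfolding inj_on_def by (metis linorder_less_linear)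
  then have "t / e < s / e + 1"
    by linarith
  then have "t - s < e"
    using assms(2) by (simp add: field_simps)
  then show thesis using st that by blast
qed

section \<open>Perfect translation bases\<close>

text \<open>Differences make this invariant under translation; \<open>dist\<close> itself is not
  assumed to be so.\<close>

definition small :: "real \<Rightarrow> 'a::{metric_space, real_vector} set \<Rightarrow> bool" where
  "small e B \<longleftrightarrow> (\<forall>y\<in>B. \<forall>z\<in>B. dist 0 (z - y) < e)"

lemma small_subset: "small e B \<Longrightarrow> A \<subseteq> B \<Longrightarrow> small e A"
  unfolding small_def by blast

lemma small_shift: "small e B \<Longrightarrow> small e ((\<lambda>x. x + r) ` B)"
  unfolding small_def by simp

text \<open>The chain condition and linear invariance are kept out, since the locale is also
  interpreted for the competing base \<open>D\<close>, of which they are not assumed.\<close>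

locale CH_translation_base =
  fixes C :: "'a::{polish_space, real_vector} set set"
  assumes CH: "continuum_hypothesis"
    and add_cont: "continuous_on UNIV (\<lambda>(x::'a, y::'a). x + y)"
    and scale_cont: "continuous_on UNIV (\<lambda>(c::real, x::'a). c *\<^sub>R x)"
    and ptb: "perfect_translation_base C"
begin

lemma continuous_on_plus:
  fixes f g :: "'b::topological_space \<Rightarrow> 'a"
  assumes "continuous_on S f" "continuous_on S g"
  shows "continuous_on S (\<lambda>x. f x + g x)"
  using continuous_on_compose2[OF add_cont continuous_on_Pair[OF assms]] by simp

lemma continuous_on_scale:
  fixes g :: "'b::topological_space \<Rightarrow> 'a"
  assumes "continuous_on S f" "continuous_on S g"
  shows "continuous_on S (\<lambda>x. f x *\<^sub>R g x)"
  using continuous_on_compose2[OF scale_cont continuous_on_Pair[OF assms]] by simp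

lemma continuous_on_minus:
  fixes f g :: "'b::topological_space \<Rightarrow> 'a"
  assumes "continuous_on S f" "continuous_on S g"
  shows "continuous_on S (\<lambda>x. f x - g x)"
  using continuous_on_plus[OF assms(1) continuous_on_scale[OF continuous_on_const[of S "-1"] assms(2)]]
  by simp

lemma base: "category_base C"
  using ptb unfolding perfect_translation_base_def perfect_base_def by blast

lemma region_perfect: "region C A \<Longrightarrow> perfect_set A"
  using ptb unfolding perfect_translation_base_def perfect_base_def by blast

lemma region_closed: "region C A \<Longrightarrow> closed A"
  using region_perfect unfolding perfect_set_def by blast

lemma region_nonempty: "region C A \<Longrightarrow> A \<noteq> {}"
  unfolding region_def by blast

lemma region_shift: "region C A \<Longrightarrow> region C ((\<lambda>x. x + r) ` A)"
  using ptb unfolding perfect_translation_base_def translation_invariant_def region_def by blast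

lemma point_in_region: "\<exists>A. region C A \<and> x \<in> A"
  using base unfolding category_base_def region_def by blast

lemma region_in_open:
  assumes "open U" "x \<in> U"
  obtains A where "region C A" "x \<in> A" "A \<subseteq> U"
proof -
  obtain S :: "nat \<Rightarrow> 'a set" where S: "\<And>n. region C (S n)" "\<And>n. x \<in> S n"
    "\<And>n. bounded (S n)" "\<And>n. diameter (S n) \<le> 1 / real (Suc n)"
    using ptb point_in_region[of x] unfolding perfect_translation_base_def perfect_base_def by metis
  obtain e where e: "e > 0" "ball x e \<subseteq> U"
    using assms by (meson open_contains_ball)
  obtain n where n: "1 / real (Suc n) < e"
    using nat_approx_posE[OF e(1)] by (metis of_nat_Suc)
  have "S n \<subseteq> ball x e"
  proof
    fix y assume "y \<in> S n"
    then have "dist x y \<le> diameter (S n)"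
      using diameter_bounded_bound[OF S(3) S(2)] by blast
    then show "y \<in> ball x e"
      using S(4)[of n] n by simp
  qed
  then show thesis
    using that S(1,2) e(2) by blast
qed

lemma islimpt_UNIV: "(x::'a) islimpt UNIV"
  using point_in_region[of x] region_perfect islimpt_subset unfolding perfect_set_def by blast

lemma dense_exists:
  obtains D :: "'a set" where "countable D" "closure D = UNIV"
proof -
  obtain D :: "'a set" where D: "countable D" "\<And>U. open U \<Longrightarrow> U \<noteq> {} \<Longrightarrow> \<exists>d\<in>D. d \<in> U"
    using countable_dense_exists by blast
  have "- closure D = {}"
    using D(2)[OF open_Compl[OF closed_closure]] closure_subset[of D] by blast
  then have "closure D = UNIV"
    by blast
  then show thesis using that D(1) by blast
qed

section \<open>Uncountability of the base\<close>

text \<open>Among the uncountably many translates of \<open>A\<close> along \<open>v\<close> two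
  with nearby parameters coincide, so \<open>A\<close> has arbitrarily small periods in that
  direction. As \<open>A\<close> is closed, it contains the whole ray from \<open>a\<close>, in
  particular \<open>a + v\<close>.\<close>

lemma countable_base_imp_region_UNIV:
  assumes C: "countable C" and A: "region C A" and a: "a \<in> A"
  shows "a + v \<in> A"
proof -
  have *: "\<exists>s. 0 < s \<and> s < e \<and> (\<lambda>x. x + s *\<^sub>R v) ` A = A" if e: "e > 0" for e
  proof -
    define \<phi> where "\<phi> t = (\<lambda>x. x + t *\<^sub>R v) ` A" for t
    have "range \<phi> \<subseteq> C"
      using region_shift[OF A] unfolding \<phi>_def region_def by blast
    then have "countable (range \<phi>)"
      using C countable_subset by blast
    moreover have "(UNIV :: real set) = (\<Union>B\<in>range \<phi>. \<phi> -` {B})"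
      by auto
    ultimately obtain B where "uncountable (\<phi> -` {B})"
      using uncountable_UNIV_real by (metis countable_UN)
    then obtain s t where st: "\<phi> s = B" "\<phi> t = B" "s < t" "t - s < e"
      using uncountable_reals_close[OF _ e] by (metis vimage_singleton_eq)
    have "(\<lambda>x. x + (t - s) *\<^sub>R v) ` A = (\<lambda>x. x - s *\<^sub>R v) ` \<phi> t"
      unfolding \<phi>_def image_image by (simp add: algebra_simps)
    also have "\<dots> = (\<lambda>x. x - s *\<^sub>R v) ` \<phi> s"
      using st by simp
    also have "\<dots> = A"
      unfolding \<phi>_def image_image by simp
    finally show ?thesis
      using st by (intro exI[of _ "t - s"]) simp
  qed
  have mult: "a + (real n * s) *\<^sub>R v \<in> A" if s: "(\<lambda>x. x + s *\<^sub>R v) ` A = A" for s n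
  proof (induction n)
    case (Suc n)
    then have "(a + (real n * s) *\<^sub>R v) + s *\<^sub>R v \<in> A"
      using s by blast
    then show ?case
      by (simp add: algebra_simps)
  qed (use a in simp)
  define L where "L = (\<lambda>r. a + r *\<^sub>R v) -` A"
  have "closed L"
    unfolding L_def
    by (intro closed_vimage region_closed[OF A] continuous_on_plus continuous_on_scale continuous_intros)
  moreover have "1 \<in> closure L"
    unfolding closure_approachable
  proof (intro allI impI)
    fix e :: real assume "e > 0"
    then obtain s where s: "0 < s" "s < e" "(\<lambda>x. x + s *\<^sub>R v) ` A = A"
      using * by blast
    \<comment> \<open>The largest multiple of \<open>s\<close> not exceeding 1 is within
      \<open>s < e\<close> of 1.\<close>
    define n where "n = nat \<lfloor>1 / s\<rfloor>"
    have n: "real n \<le> 1 / s" "1 / s < real n + 1"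
      unfolding n_def using s(1) by (simp_all add: of_nat_nat)
    have "real n * s \<le> 1" "1 < real n * s + s"
      using n s(1) by (simp_all add: field_simps)
    then have "dist (real n * s) 1 < e"
      using s(2) by (simp add: dist_real_def)
    then show "\<exists>y\<in>L. dist y 1 < e"
      using mult[OF s(3), of n] unfolding L_def by blast
  qed
  ultimately show ?thesis
    unfolding L_def by (simp add: closure_closed)
qed

text \<open>This makes the base axiom, which concerns families of cardinality below that of
  \<open>C\<close>, available for all countable families. If \<open>C\<close> were countable, every
  region would be the whole space, yet some region around 0 avoids a given nonzero point.\<close>

lemma uncountable_base: "uncountable C"
proof
  assume "countable C"
  have *: "y \<in> A" if A: "region C A" for A y
  proof -
    obtain a where "a \<in> A"
      using region_nonempty[OF A] by blast
    then have "a + (y - a) \<in> A"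
      by (rule countable_base_imp_region_UNIV[OF \<open>countable C\<close> A])
    then show ?thesis by simp
  qed
  obtain y :: 'a where "y \<noteq> 0"
    using islimptE[OF islimpt_UNIV[of 0] UNIV_I open_UNIV] by metis
  then have "0 \<in> - {y}"
    by simp
  then obtain A where "region C A" "A \<subseteq> - {y}"
    using region_in_open[OF open_Compl[OF closed_singleton[of y]]] by metis
  then show False
    using * by blast
qed

section \<open>Splitting of regions, translates and small subregions\<close>

text \<open>Both clauses of the base axiom at once: which one applies depends on whether
  \<open>A \<inter> \<Union>F\<close> contains a region.\<close>

lemma region_split:
  assumes A: "region C A" and F: "countable F" "pairwise disjnt F" "\<And>E. E \<in> F \<Longrightarrow> region C E"
  shows "(\<exists>E\<in>F. \<exists>R. region C R \<and> R \<subseteq> A \<inter> E) \<or> (\<exists>B. region C B \<and> B \<subseteq> A \<and> B \<inter> \<Union>F = {})"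
proof (cases "F = {}")
  case True
  then show ?thesis using A by blast
next
  case False
  have "F \<lesssim> (UNIV :: nat set)"
    using F(1) unfolding countable_def lepoll_def by blast
  moreover have "(UNIV :: nat set) \<lesssim> C"
    using uncountable_base uncountable_infinite infinite_le_lepoll by blast
  ultimately have "F \<prec> C"
    using F(1) uncountable_base unfolding lesspoll_def
    by (meson countable_eqpoll eqpoll_sym lepoll_trans)
  then have "((\<exists>R. region C R \<and> R \<subseteq> A \<inter> \<Union>F) \<longrightarrow> (\<exists>E\<in>F. \<exists>R. region C R \<and> R \<subseteq> A \<inter> E)) \<and>
        (\<not> (\<exists>R. region C R \<and> R \<subseteq> A \<inter> \<Union>F) \<longrightarrow> (\<exists>B. region C B \<and> B \<subseteq> A \<and> (\<forall>E\<in>F. B \<inter> E = {})))"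
    using base A F False unfolding category_base_def by simp
  then show ?thesis
    by blast
qed

lemma region_split2:
  assumes "region C A" "region C B"
  shows "(\<exists>R. region C R \<and> R \<subseteq> A \<inter> B) \<or> (\<exists>R. region C R \<and> R \<subseteq> A \<and> R \<inter> B = {})"
  using region_split[of A "{B}"] assms by (simp add: pairwise_def)

text \<open>A region without a subregion missing \<open>A\<close> has one inside \<open>A\<close>;
  splitting the latter by \<open>B\<close> must give a subregion missing \<open>B\<close>.\<close>

lemma singular_Int:
  assumes A: "region C A" "region C B" and no: "\<And>R. region C R \<Longrightarrow> \<not> R \<subseteq> A \<inter> B"
  shows "singular C (A \<inter> B)"
  unfolding singular_def
proof (intro allI impI)
  fix Q assume Q: "region C Q"
  show "\<exists>R. region C R \<and> R \<subseteq> Q \<and> R \<inter> (A \<inter> B) = {}"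
  proof (cases "\<exists>R. region C R \<and> R \<subseteq> Q \<and> R \<inter> A = {}")
    case False
    then obtain R where R: "region C R" "R \<subseteq> Q \<inter> A"
      using region_split2[OF Q A(1)] by blast
    then show ?thesis
      using region_split2[OF R(1) A(2)] no by (metis inf.bounded_iff inf.boundedE inf_commute
          inf_left_commute inf_bot_right order_trans)
  qed blast
qed

lemma meager_shift: "meager C S \<Longrightarrow> meager C ((\<lambda>x. x + r) ` S)"
proof (rule meager_image[where g = "\<lambda>x. x - r"])
  fix E assume E: "E \<in> C"
  show "(\<lambda>x. x + r) ` E \<in> C" "(\<lambda>x. x - r) ` E \<in> C"
    using ptb E unfolding perfect_translation_base_def translation_invariant_def
    by (auto simp: diff_conv_add_uminus simp del: add_uminus_conv_diff)
qed auto

lemma abundant_translates: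
  assumes "region C A" "region C B" "countable D" "closure D = UNIV"
  shows "\<not> meager C ((\<Union>r\<in>D. (\<lambda>x. x + r) ` A) \<inter> B)"
  using ptb assms unfolding perfect_translation_base_def abundant_everywhere_def abundant_def by blast

lemma region_abundant: "region C A \<Longrightarrow> \<not> meager C A"
  using abundant_translates dense_exists meager_subset by (metis inf_le2)

text \<open>Otherwise each translate of \<open>A\<close> would meet \<open>B\<close> in a singular
  set, and the union over \<open>D\<close> would be meager in \<open>B\<close>.\<close>

lemma region_meets_translate:
  assumes "region C A" "region C B" "countable D" "closure D = UNIV"
  obtains r R where "r \<in> D" "region C R" "R \<subseteq> (\<lambda>x. x + r) ` A" "R \<subseteq> B"
proof -
  have "\<exists>r\<in>D. \<exists>R. region C R \<and> R \<subseteq> (\<lambda>x. x + r) ` A \<inter> B"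
  proof (rule ccontr)
    assume "\<not> ?thesis"
    then have "meager C ((\<lambda>x. x + r) ` A \<inter> B)" if "r \<in> D" for r
      using that assms(1,2) region_shift by (intro singular_meager singular_Int) auto
    then have "meager C (\<Union>r\<in>D. (\<lambda>x. x + r) ` A \<inter> B)"
      using assms(3) by (rule meager_Union[rotated])
    then show False
      using abundant_translates[OF assms] by simp
  qed
  then show thesis
    using that by blast
qed

text \<open>Regions of a perfect base are not required to have small subregions. A small region
  exists around every point, and abundance of the union of its translates puts a translate
  of a small region inside every region; hence smallness is measured by differences.\<close>

lemma small_subregion:
  assumes A: "region C A" and e: "e > 0"
  obtains B where "region C B" "B \<subseteq> A" "small e B"
proof -
  \<comment> \<open>Subtraction is continuous at \<open>(0, 0)\<close>, so all differences of points
    near 0 are within \<open>e\<close> of 0.\<close>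
  have "open {p :: 'a \<times> 'a. dist 0 (snd p - fst p) < e}"
    by (intro open_Collect_less continuous_intros continuous_on_minus)
  then obtain U V :: "'a set" where UV: "open U" "open V" "0 \<in> U" "0 \<in> V"
    "U \<times> V \<subseteq> {p. dist 0 (snd p - fst p) < e}"
    using open_prod_elim[of _ "(0, 0)"] e
    by (smt (verit) SigmaE2 dist_self diff_self fst_conv mem_Collect_eq snd_conv)
  obtain S where S: "region C S" "S \<subseteq> U \<inter> V"
    using region_in_open[of "U \<inter> V" 0] UV by (metis IntI open_Int)
  have "small e S"
    using S(2) UV(5) unfolding small_def by fastforce
  then show thesis
    using region_meets_translate[OF S(1) A] dense_exists that small_subset small_shift by metis
qed

text \<open>Suppose \<open>x\<close> lies in every subregion of some region \<open>A\<close>. If a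
  region were contained in both \<open>A\<close> and \<open>A + t\<close> with
  \<open>t \<noteq> 0\<close>, it would have a subregion \<open>B\<close> too small to contain two
  points differing by \<open>t\<close>; but \<open>B\<close> and \<open>B - t\<close> are subregions
  of \<open>A\<close>, so both \<open>x\<close> and \<open>x + t\<close> lie in \<open>B\<close>.
  Hence no nonzero translate of \<open>A\<close> shares a region with \<open>A\<close>, contrary to
  \<open>region_meets_translate\<close>.\<close>

lemma singular_singleton: "singular C {x}"
proof (rule ccontr)
  assume "\<not> singular C {x}"
  then obtain A where A: "region C A" and x: "\<And>B. region C B \<Longrightarrow> B \<subseteq> A \<Longrightarrow> x \<in> B"
    unfolding singular_def by blast
  have no: "\<not> R \<subseteq> (\<lambda>y. y + t) ` A \<inter> A" if t: "t \<noteq> 0" and R: "region C R" for t R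
  proof
    assume sub: "R \<subseteq> (\<lambda>y. y + t) ` A \<inter> A"
    obtain B where B: "region C B" "B \<subseteq> R" "small (dist 0 t) B"
      using small_subregion[OF R] t by (metis dist_nz)
    have "x \<in> B"
      using x B sub by blast
    moreover have "x \<in> (\<lambda>y. y + - t) ` B"
      using B sub by (intro x region_shift) auto
    ultimately have "x \<in> B" "x + t \<in> B"
      by auto
    then have "dist 0 (x + t - x) < dist 0 t"
      using B(3) unfolding small_def by blast
    then show False by simp
  qed
  obtain D :: "'a set" where D: "countable D" "closure D = UNIV"
    by (rule dense_exists)
  \<comment> \<open>The claim \<open>no\<close> covers nonzero translations only; density survives
    removing 0 because the space has no isolated points.\<close>
  have "closure (D - {0}) = UNIV"
  proof -
    have "y \<in> closure (D - {0})" for y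
      unfolding closure_iff_nhds_not_empty
    proof (intro allI impI)
      fix S V assume "V \<subseteq> S" "open V" "y \<in> V"
      obtain z where z: "z \<in> V" "z \<noteq> 0"
      proof (cases "y = 0")
        case True
        then show thesis
          using islimptE[OF islimpt_UNIV \<open>y \<in> V\<close> \<open>open V\<close>] that by metis
      qed (use \<open>y \<in> V\<close> that in blast)
      have "open (V - {0})"
        using \<open>open V\<close> by (simp add: open_Diff)
      then have "D \<inter> (V - {0}) \<noteq> {}"
        using D(2) z by (metis DiffI UNIV_I all_not_in_conv closure_iff_nhds_not_empty
            inf_commute order_refl singletonD)
      then show "(D - {0}) \<inter> S \<noteq> {}"
        using \<open>V \<subseteq> S\<close> by blast
    qed
    then show ?thesis by blast
  qed
  then obtain r R where "r \<in> D - {0}" "region C R" "R \<subseteq> (\<lambda>x. x + r) ` A" "R \<subseteq> A"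
    using region_meets_translate[OF A A, of "D - {0}"] D(1) by (metis countable_Diff)
  then show False
    using no by blast
qed

lemma countable_meager: "countable S \<Longrightarrow> meager C S"
  unfolding meager_iff by (rule exI[of _ "(\<lambda>x. {x}) ` S"]) (auto simp: singular_singleton)

section \<open>Maximal disjoint families of regions and the Banach category theorem\<close>

text \<open>Recursion along a well-order of the reals with countable initial segments, over an
  enumeration of all closed sets and hence of all regions. Each stage has only countably many
  predecessors, so \<open>region_split\<close> applies to the earlier choices although the whole
  family may be uncountable.\<close>

lemma disjoint_refinement:
  assumes reg: "\<And>N. N \<in> \<N> \<Longrightarrow> region C N"
    and down: "\<And>N B. N \<in> \<N> \<Longrightarrow> region C B \<Longrightarrow> B \<subseteq> N \<Longrightarrow> B \<in> \<N>"
    and dense: "\<And>A. region C A \<Longrightarrow> \<exists>N\<in>\<N>. N \<subseteq> A"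
  obtains M where "M \<subseteq> \<N>" "pairwise disjnt M"
    "\<And>A. region C A \<Longrightarrow> \<exists>E\<in>M. \<exists>R. region C R \<and> R \<subseteq> A \<inter> E"
proof -
  obtain W :: "real rel" where W: "wf W" "\<And>x y. x \<noteq> y \<Longrightarrow> (x, y) \<in> W \<or> (y, x) \<in> W"
    "\<And>x. countable {y. (y, x) \<in> W}"
    using CH_well_order[OF CH] by blast
  obtain g :: "real \<Rightarrow> 'a set" where g: "\<And>F. closed F \<Longrightarrow> \<exists>x. g x = F"
    using real_enumerates_closed_sets by metis
  \<comment> \<open>Admissible choices at stage \<open>x\<close>: subregions of \<open>g x\<close>
    disjoint from everything chosen before.\<close>
  define Q where "Q f x r \<longleftrightarrow> region C r \<and> r \<subseteq> g x \<and> (\<forall>y. (y, x) \<in> W \<longrightarrow> r \<inter> f y = {})"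
    for f x r
  \<comment> \<open>The value \<open>{}\<close> marks a stage at which nothing is chosen.\<close>
  define P where "P f x r \<longleftrightarrow> (if g x \<in> \<N> \<and> (\<exists>r. Q f x r) then Q f x r else r = {})" for f x r
  have cong: "Q f x = Q h x" if "\<And>y. (y, x) \<in> W \<Longrightarrow> f y = h y" for f h x
    using that unfolding Q_def by (intro ext) auto
  have "\<exists>f. \<forall>x. P f x (f x)"
  proof (rule dependent_wf_choice[OF W(1)])
    fix f h :: "real \<Rightarrow> 'a set" and x r assume "\<And>y. (y, x) \<in> W \<Longrightarrow> f y = h y"
    then have "Q f x = Q h x"
      by (rule cong)
    then show "P f x r = P h x r"
      unfolding P_def by (simp only:)
  next
    fix x and f :: "real \<Rightarrow> 'a set"
    show "\<exists>r. P f x r"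
      unfolding P_def by auto
  qed
  then obtain f where f: "\<And>x. P f x (f x)"
    by blast
  have fN: "f x \<in> \<N> \<and> Q f x (f x)" if "f x \<noteq> {}" for x
    using f[of x] that down unfolding P_def Q_def by (metis (full_types))
  define M where "M = range f - {{}}"
  have "M \<subseteq> \<N>"
    unfolding M_def using fN by blast
  moreover have "pairwise disjnt M"
  proof -
    have "f x \<inter> f y = {}" if "x \<noteq> y" for x y
      using W(2)[OF that] fN[of x] fN[of y] unfolding Q_def by blast
    then show ?thesis
      unfolding M_def pairwise_def disjnt_def by (metis DiffE imageE)
  qed
  moreover have "\<exists>E\<in>M. \<exists>R. region C R \<and> R \<subseteq> A \<inter> E" if A: "region C A" for A
  proof -
    obtain N where N: "N \<in> \<N>" "N \<subseteq> A"
      using dense[OF A] by blast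
    then obtain x where x: "g x = N"
      using g region_closed reg by blast
    show ?thesis
    proof (cases "f x = {}")
      case False
      then have "f x \<in> M" "region C (f x)" "f x \<subseteq> A \<inter> f x"
        using fN[OF False] N(2) x unfolding M_def Q_def by auto
      then show ?thesis by blast
    next
      case True
      \<comment> \<open>Stage \<open>x\<close> came out empty because no subregion of
        \<open>N\<close> avoids all earlier choices; \<open>region_split\<close> then finds an
        earlier choice sharing a region with \<open>N\<close>.\<close>
      then have no: "\<not> Q f x r" for r
        using f[of x] N(1) x unfolding P_def Q_def by (metis (full_types) region_nonempty)
      define F where "F = f ` {y. (y, x) \<in> W} - {{}}"
      have FM: "F \<subseteq> M"
        unfolding F_def M_def by blast
      have "(\<exists>E\<in>F. \<exists>R. region C R \<and> R \<subseteq> N \<inter> E) \<or> (\<exists>B. region C B \<and> B \<subseteq> N \<and> B \<inter> \<Union>F = {})"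
      proof (rule region_split)
        show "region C N"
          using reg N(1) .
        show "countable F"
          unfolding F_def using W(3) by blast
        show "pairwise disjnt F"
          using \<open>pairwise disjnt M\<close> FM by (rule pairwise_subset)
        show "region C E" if "E \<in> F" for E
          using that FM \<open>M \<subseteq> \<N>\<close> reg by blast
      qed
      moreover have "\<not> (region C B \<and> B \<subseteq> N \<and> B \<inter> \<Union>F = {})" for B
      proof
        assume B: "region C B \<and> B \<subseteq> N \<and> B \<inter> \<Union>F = {}"
        then have "Q f x B"
          unfolding Q_def F_def x by blast
        then show False using no by blast
      qed
      ultimately obtain E R where "E \<in> F" "region C R" "R \<subseteq> N \<inter> E"
        by blast
      then show ?thesis
        using FM N(2) by blast
    qed
  qed
  ultimately show thesis
    by (rule that)
qed

text \<open>Banach's category theorem. A disjoint family \<open>M\<close> of regions in which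
  \<open>S\<close> is meager captures a subregion of every region. The \<open>n\<close>-th singular
  pieces of \<open>S\<close> in its members glue to a single singular set, even for uncountable
  \<open>M\<close>.\<close>

lemma locally_meager_imp_meager:
  assumes loc: "\<And>A. region C A \<Longrightarrow> \<exists>B. region C B \<and> B \<subseteq> A \<and> meager C (B \<inter> S)"
  shows "meager C S"
proof -
  let ?\<N> = "{B. region C B \<and> meager C (B \<inter> S)}"
  obtain M where M: "M \<subseteq> ?\<N>" "pairwise disjnt M"
    "\<And>A. region C A \<Longrightarrow> \<exists>E\<in>M. \<exists>R. region C R \<and> R \<subseteq> A \<inter> E"
  proof (rule disjoint_refinement[of ?\<N>])
    fix N B assume "N \<in> ?\<N>" "region C B" "B \<subseteq> N"
    then show "B \<in> ?\<N>"
      using meager_subset[of C "N \<inter> S" "B \<inter> S"] by blast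
  qed (use loc in blast)+
  have "\<exists>T :: nat \<Rightarrow> 'a set. (\<forall>n. singular C (T n)) \<and> E \<inter> S = (\<Union>n. T n)" if "E \<in> M" for E
    using M(1) that meager_sequence[of C "E \<inter> S"] by (metis (no_types, lifting) CollectD subsetD)
  then obtain T :: "'a set \<Rightarrow> nat \<Rightarrow> 'a set"
    where T: "\<And>E n. E \<in> M \<Longrightarrow> singular C (T E n)" "\<And>E. E \<in> M \<Longrightarrow> E \<inter> S = (\<Union>n. T E n)"
    by metis
  have sing: "singular C (\<Union>E\<in>M. T E n)" for n
    unfolding singular_def
  proof (intro allI impI)
    fix A assume "region C A"
    then obtain E R where E: "E \<in> M" "region C R" "R \<subseteq> A \<inter> E"
      using M(3) by blast
    then obtain B where B: "region C B" "B \<subseteq> R" "B \<inter> T E n = {}"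
      using T(1) unfolding singular_def by blast
    \<comment> \<open>Pieces belonging to other members lie in those members, while \<open>B\<close>
      lies in \<open>E\<close>.\<close>
    have "B \<inter> T E' n = {}" if "E' \<in> M" for E'
    proof (cases "E' = E")
      case False
      then have "E' \<inter> E = {}"
        using M(2) E(1) that unfolding pairwise_def disjnt_def by blast
      then show ?thesis
        using T(2)[OF that] E(3) B(2) by blast
    qed (use B(3) in simp)
    then show "\<exists>B. region C B \<and> B \<subseteq> A \<and> B \<inter> (\<Union>E\<in>M. T E n) = {}"
      using B E(3) by (intro exI[of _ B]) blast
  qed
  have "singular C (- \<Union>M)"
    unfolding singular_def
  proof (intro allI impI)
    fix A assume "region C A"
    then obtain E R where "E \<in> M" "region C R" "R \<subseteq> A \<inter> E"
      using M(3) by blast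
    then show "\<exists>B. region C B \<and> B \<subseteq> A \<and> B \<inter> - \<Union>M = {}"
      by (intro exI[of _ R]) blast
  qed
  then have "meager C ((\<Union>n. \<Union>E\<in>M. T E n) \<union> - \<Union>M)"
    using sing by (intro meager_Un meager_Union singular_meager) auto
  moreover have "S \<subseteq> (\<Union>n. \<Union>E\<in>M. T E n) \<union> - \<Union>M"
  proof
    fix x assume "x \<in> S"
    show "x \<in> (\<Union>n. \<Union>E\<in>M. T E n) \<union> - \<Union>M"
    proof (cases "x \<in> \<Union>M")
      case True
      then obtain E where "E \<in> M" "x \<in> E \<inter> S"
        using \<open>x \<in> S\<close> by blast
      then show ?thesis
        using T(2)[of E] by auto
    qed simp
  qed
  ultimately show ?thesis
    by (rule meager_subset)
qed

text \<open>The category theorem inside \<open>A\<close>: any region has a subregion either within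
  \<open>A\<close>, where the hypothesis applies, or disjoint from \<open>A\<close>.\<close>

lemma meager_in_region:
  assumes A: "region C A"
    and loc: "\<And>B. region C B \<Longrightarrow> B \<subseteq> A \<Longrightarrow> \<exists>B'. region C B' \<and> B' \<subseteq> B \<and> meager C (B' \<inter> S)"
  shows "meager C (A \<inter> S)"
proof (rule locally_meager_imp_meager)
  fix R assume R: "region C R"
  from region_split2[OF R A]
  show "\<exists>B. region C B \<and> B \<subseteq> R \<and> meager C (B \<inter> (A \<inter> S))"
  proof
    assume "\<exists>Q. region C Q \<and> Q \<subseteq> R \<inter> A"
    then obtain Q where Q: "region C Q" "Q \<subseteq> R \<inter> A"
      by blast
    then obtain B where "region C B" "B \<subseteq> Q" "meager C (B \<inter> S)"
      using loc[of Q] by blast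
    then show ?thesis
      using Q meager_subset[of C "B \<inter> S" "B \<inter> (A \<inter> S)"] by blast
  next
    assume "\<exists>Q. region C Q \<and> Q \<subseteq> R \<and> Q \<inter> A = {}"
    then obtain Q where "region C Q" "Q \<subseteq> R" "Q \<inter> (A \<inter> S) = {}"
      by blast
    then show ?thesis
      by (intro exI[of _ Q]) simp
  qed
qed

lemma abundant_obtain_region:
  assumes "\<not> meager C S"
  obtains A where "region C A" "\<And>B. region C B \<Longrightarrow> B \<subseteq> A \<Longrightarrow> \<not> meager C (B \<inter> S)"
  using assms locally_meager_imp_meager by blast

section \<open>Baire sets, Borel sets and a zero-one law for translates\<close>

lemma baire_Compl: "baire_set C E \<Longrightarrow> baire_set C (- E)"
  unfolding baire_set_def Compl_eq_Diff_UNIV by (metis double_diff order_refl subset_UNIV)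

text \<open>If some \<open>E n\<close> is comeager in a subregion, so is the union. Otherwise the
  Baire property makes every \<open>E n\<close> locally meager in \<open>A\<close>, and the category
  theorem gives a meager union there.\<close>

lemma baire_Union:
  assumes "\<And>n::nat. baire_set C (E n)"
  shows "baire_set C (\<Union>n. E n)"
  unfolding baire_set_def
proof (intro allI impI)
  fix A assume A: "region C A"
  show "\<exists>B. region C B \<and> B \<subseteq> A \<and> (meager C (B \<inter> (\<Union>n. E n)) \<or> meager C (B \<inter> (UNIV - (\<Union>n. E n))))"
  proof (cases "\<exists>n B. region C B \<and> B \<subseteq> A \<and> meager C (B \<inter> (UNIV - E n))")
    case True
    then obtain n B where "region C B" "B \<subseteq> A" "meager C (B \<inter> (UNIV - E n))"
      by blast
    moreover have "B \<inter> (UNIV - (\<Union>n. E n)) \<subseteq> B \<inter> (UNIV - E n)"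
      by blast
    ultimately show ?thesis
      using meager_subset by blast
  next
    case False
    have "meager C (A \<inter> E n)" for n
      using A
    proof (rule meager_in_region)
      fix B assume "region C B" "B \<subseteq> A"
      then show "\<exists>B'. region C B' \<and> B' \<subseteq> B \<and> meager C (B' \<inter> E n)"
        using assms[of n] False unfolding baire_set_def by (meson order_trans)
    qed
    then have "meager C (\<Union>n. A \<inter> E n)"
      by (intro meager_Union) auto
    then show ?thesis
      using A by (intro exI[of _ A]) simp
  qed
qed

lemma closed_baire:
  assumes "closed F"
  shows "baire_set C F"
proof -
  \<comment> \<open>Points of the complement at least \<open>1 / (n + 1)\<close> away from
    \<open>F\<close>, measured by differences. They exhaust \<open>- F\<close>, and a region small
    at this scale cannot meet both \<open>U n\<close> and \<open>F\<close>.\<close>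
  define U where "U n = {x. \<forall>z. dist 0 (z - x) < 1 / real (Suc n) \<longrightarrow> z \<notin> F}" for n
  have U: "- F \<subseteq> (\<Union>n. U n)"
  proof
    fix x assume x: "x \<in> - F"
    have "continuous_on UNIV (\<lambda>w. x + w)"
      by (intro continuous_on_plus continuous_intros)
    then have "open ((\<lambda>w. x + w) -` (- F))"
      using assms by (intro open_vimage) (auto simp: open_Compl)
    moreover have "0 \<in> (\<lambda>w. x + w) -` (- F)"
      using x by simp
    ultimately obtain e where e: "e > 0" "ball 0 e \<subseteq> (\<lambda>w. x + w) -` (- F)"
      by (meson open_contains_ball)
    obtain n where n: "1 / real (Suc n) < e"
      using nat_approx_posE[OF e(1)] by (metis of_nat_Suc)
    have "z \<notin> F" if "dist 0 (z - x) < 1 / real (Suc n)" for z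
    proof -
      have "z - x \<in> ball 0 e"
        using that n by simp
      then have "x + (z - x) \<in> - F"
        using e(2) by blast
      then show ?thesis by simp
    qed
    then show "x \<in> (\<Union>n. U n)"
      unfolding U_def by blast
  qed
  show ?thesis
    unfolding baire_set_def
  proof (intro allI impI)
    fix A assume A: "region C A"
    show "\<exists>B. region C B \<and> B \<subseteq> A \<and> (meager C (B \<inter> F) \<or> meager C (B \<inter> (UNIV - F)))"
    proof (cases "\<exists>B. region C B \<and> B \<subseteq> A \<and> B \<inter> F = {}")
      case True
      then show ?thesis
        by (metis meager_empty)
    next
      case False
      have "meager C (A \<inter> U n)" for n
        using A
      proof (rule meager_in_region)
        fix B assume B: "region C B" "B \<subseteq> A"
        obtain B' where B': "region C B'" "B' \<subseteq> B" "small (1 / real (Suc n)) B'"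
          using small_subregion[OF B(1), of "1 / real (Suc n)"] by auto
        have "B' \<inter> U n = {}"
        proof (rule ccontr)
          assume "B' \<inter> U n \<noteq> {}"
          then have "B' \<inter> F = {}"
            using B'(3) unfolding small_def U_def by blast
          then show False
            using False B'(1,2) B(2) by blast
        qed
        then show "\<exists>B'. region C B' \<and> B' \<subseteq> B \<and> meager C (B' \<inter> U n)"
          using B'(1,2) by (metis meager_empty)
      qed
      then have "meager C (\<Union>n. A \<inter> U n)"
        by (intro meager_Union) auto
      then have "meager C (A \<inter> (UNIV - F))"
        by (rule meager_subset) (use U in blast)
      then show ?thesis
        using A by blast
    qed
  qed
qed

lemma borel_baire: "E \<in> sets borel \<Longrightarrow> baire_set C E"
  unfolding sets_borel
proof (induction rule: sigma_sets.induct)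
  case (Basic a)
  then show ?case
    using baire_Compl[OF closed_baire[of "- a"]] by (simp add: closed_Compl)
next
  case Empty
  show ?case
    using closed_baire[OF closed_empty] .
next
  case (Compl a)
  then show ?case
    using baire_Compl by (simp add: Compl_eq_Diff_UNIV)
next
  case (Union a)
  then show ?case
    by (intro baire_Union)
qed

text \<open>In a region where \<open>E\<close> is nowhere locally meager, the Baire property leaves
  only the other alternative.\<close>

lemma abundant_baire_obtain_region:
  assumes "baire_set C E" "\<not> meager C E"
  obtains A where "region C A" "meager C (A - E)"
proof -
  obtain A where A: "region C A" "\<And>B. region C B \<Longrightarrow> B \<subseteq> A \<Longrightarrow> \<not> meager C (B \<inter> E)"
    using abundant_obtain_region[OF assms(2)] by metis
  then obtain B where B: "region C B" "B \<subseteq> A" "meager C (B \<inter> (UNIV - E))"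
    using assms(1) unfolding baire_set_def by blast
  have "B \<inter> (UNIV - E) = B - E"
    by blast
  then show thesis
    using that B by metis
qed

lemma baire_meager_Diff:
  assumes "baire_set C G" "meager C (E - G)" "meager C (G - E)"
  shows "baire_set C E"
  unfolding baire_set_def
proof (intro allI impI)
  fix A assume "region C A"
  then obtain B where B: "region C B" "B \<subseteq> A" "meager C (B \<inter> G) \<or> meager C (B \<inter> (UNIV - G))"
    using assms(1) unfolding baire_set_def by blast
  have "B \<inter> E \<subseteq> B \<inter> G \<union> (E - G)" "B \<inter> (UNIV - E) \<subseteq> B \<inter> (UNIV - G) \<union> (G - E)"
    by blast+
  then have "meager C (B \<inter> E) \<or> meager C (B \<inter> (UNIV - E))"
    using B(3) assms(2,3) by (meson meager_Un meager_subset)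
  then show "\<exists>B. region C B \<and> B \<subseteq> A \<and> (meager C (B \<inter> E) \<or> meager C (B \<inter> (UNIV - E)))"
    using B by blast
qed

text \<open>A zero-one law. \<open>E\<close> is comeager in a region \<open>A\<close>, whose
  translates \<open>?Y\<close> are abundant everywhere and form a Borel set. An abundant complement
  of \<open>?Y\<close> would be comeager in some region, making \<open>?Y\<close> meager there.
  Passing from \<open>A\<close> to \<open>E\<close> loses only countably many translates of the
  meager set \<open>A - E\<close>.\<close>

lemma saturation_comeager:
  assumes E: "baire_set C E" "\<not> meager C E" and D: "countable D" "closure D = UNIV"
  shows "meager C (- (\<Union>r\<in>D. (\<lambda>x. x + r) ` E))"
proof -
  obtain A where A: "region C A" "meager C (A - E)"
    using abundant_baire_obtain_region[OF E] .
  let ?Y = "\<Union>r\<in>D. (\<lambda>x. x + r) ` A"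
  have "?Y \<in> sets borel"
    using D(1) region_closed[OF region_shift[OF A(1)]] by (intro sets.countable_UN') auto
  then have "baire_set C (- ?Y)"
    using baire_Compl borel_baire by blast
  have Y: "meager C (- ?Y)"
  proof (rule ccontr)
    assume "\<not> meager C (- ?Y)"
    then obtain B where B: "region C B" "meager C (B - - ?Y)"
      using abundant_baire_obtain_region \<open>baire_set C (- ?Y)\<close> by blast
    have "?Y \<inter> B = B - - ?Y"
      by blast
    then show False
      using abundant_translates[OF A(1) B(1) D] B(2) by metis
  qed
  have "meager C (\<Union>r\<in>D. (\<lambda>x. x + r) ` (A - E))"
    using D(1) meager_shift[OF A(2)] by (intro meager_Union)
  then have "meager C (- ?Y \<union> (\<Union>r\<in>D. (\<lambda>x. x + r) ` (A - E)))"
    using Y by (rule meager_Un[rotated])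
  then show ?thesis
    by (rule meager_subset) blast
qed

section \<open>The countable chain condition\<close>

lemma ccc_refinement:
  assumes ccc: "ccc_base C"
    and reg: "\<And>N. N \<in> \<N> \<Longrightarrow> region C N"
    and down: "\<And>N B. N \<in> \<N> \<Longrightarrow> region C B \<Longrightarrow> B \<subseteq> N \<Longrightarrow> B \<in> \<N>"
    and dense: "\<And>A. region C A \<Longrightarrow> \<exists>N\<in>\<N>. N \<subseteq> A"
  obtains M where "M \<subseteq> \<N>" "countable M" "singular C (- \<Union>M)"
    "\<And>A. region C A \<Longrightarrow> \<exists>E\<in>M. \<exists>R. region C R \<and> R \<subseteq> A \<inter> E"
proof (rule disjoint_refinement[OF reg down dense])
  fix M assume M: "M \<subseteq> \<N>" "pairwise disjnt M"
    "\<And>A. region C A \<Longrightarrow> \<exists>E\<in>M. \<exists>R. region C R \<and> R \<subseteq> A \<inter> E"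
  have "countable M"
    using ccc M(1,2) reg unfolding ccc_base_def by blast
  moreover have "singular C (- \<Union>M)"
    unfolding singular_def
  proof (intro allI impI)
    fix A assume "region C A"
    then obtain E R where "E \<in> M" "region C R" "R \<subseteq> A \<inter> E"
      using M(3) by blast
    then show "\<exists>B. region C B \<and> B \<subseteq> A \<and> B \<inter> - \<Union>M = {}"
      by (intro exI[of _ R]) blast
  qed
  ultimately show thesis
    by (rule that[OF M(1) _ _ M(3)])
qed

text \<open>The closed sets are the members of a countable maximal disjoint family of regions
  missing \<open>S\<close>. The cover is thus a G-delta coded by a sequence of closed sets, a form
  that the reals can enumerate.\<close>

lemma ccc_singular_cover:
  assumes "ccc_base C" "singular C S"
  obtains F :: "nat \<Rightarrow> 'a set"
    where "\<And>n. closed (F n)" "singular C (- (\<Union>n. F n))" "S \<subseteq> - (\<Union>n. F n)"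
proof -
  let ?\<N> = "{B. region C B \<and> B \<inter> S = {}}"
  obtain M where M: "M \<subseteq> ?\<N>" "countable M" "singular C (- \<Union>M)"
  proof (rule ccc_refinement[OF assms(1), of ?\<N>])
    fix A assume "region C A"
    then show "\<exists>N\<in>?\<N>. N \<subseteq> A"
      using assms(2) unfolding singular_def by blast
  qed blast+
  define F where "F = from_nat_into (insert {} M)"
  have F: "range F = insert {} M"
    unfolding F_def using M(2) by (simp add: range_from_nat_into)
  have "closed (F n)" for n
    using F M(1) region_closed by (metis (no_types, lifting) closed_empty insertE mem_Collect_eq
        rangeI subsetD)
  moreover have "(\<Union>n. F n) = \<Union>M"
    unfolding F by simp
  ultimately show thesis
    using that[of F] M(1,3) by auto
qed

lemma ccc_meager_borel_cover:
  assumes ccc: "ccc_base C" and S: "meager C S"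
  obtains G where "G \<in> sets borel" "S \<subseteq> G" "meager C G"
proof -
  obtain T :: "nat \<Rightarrow> 'a set" where T: "\<And>n. singular C (T n)" "S = (\<Union>n. T n)"
    using meager_sequence[OF S] by metis
  have "\<exists>F :: nat \<Rightarrow> 'a set. (\<forall>m. closed (F m)) \<and> singular C (- (\<Union>m. F m)) \<and> T n \<subseteq> - (\<Union>m. F m)" for n
    using ccc_singular_cover[OF ccc T(1)[of n]] by metis
  then obtain F :: "nat \<Rightarrow> nat \<Rightarrow> 'a set" where F: "\<And>n m. closed (F n m)"
    "\<And>n. singular C (- (\<Union>m. F n m))" "\<And>n. T n \<subseteq> - (\<Union>m. F n m)"
    by metis
  have "- (\<Union>m. F n m) \<in> sets borel" for n
    using F(1) by (intro borel_comp sets.countable_UN) auto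
  then have "(\<Union>n. - (\<Union>m. F n m)) \<in> sets borel"
    by (intro sets.countable_UN) auto
  moreover have "S \<subseteq> (\<Union>n. - (\<Union>m. F n m))"
    unfolding T(2) by (intro UN_mono F(3)) simp
  moreover have "meager C (\<Union>n. - (\<Union>m. F n m))"
    using F(2) by (intro meager_Union singular_meager) auto
  ultimately show thesis
    by (rule that)
qed

lemma ccc_baire_borel_approximation:
  assumes ccc: "ccc_base C" and E: "baire_set C E"
  obtains G where "G \<in> sets borel" "meager C (E - G)" "meager C (G - E)"
proof -
  let ?\<N> = "{B. region C B \<and> (meager C (B \<inter> E) \<or> meager C (B - E))}"
  obtain M where M: "M \<subseteq> ?\<N>" "countable M" "singular C (- \<Union>M)"
  proof (rule ccc_refinement[OF ccc, of ?\<N>])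
    fix A assume "region C A"
    moreover have "B \<inter> (UNIV - E) = B - E" for B
      by blast
    ultimately show "\<exists>N\<in>?\<N>. N \<subseteq> A"
      using E unfolding baire_set_def by auto
  next
    fix N B assume "N \<in> ?\<N>" "region C B" "B \<subseteq> N"
    then show "B \<in> ?\<N>"
      using meager_subset[of C "N \<inter> E" "B \<inter> E"] meager_subset[of C "N - E" "B - E"] by blast
  qed blast+
  \<comment> \<open>The members of the countable family \<open>M\<close> in which \<open>E\<close>
    is comeager; in the others \<open>E\<close> is meager, so their union is the Borel
    approximation.\<close>
  define K where "K = {B\<in>M. meager C (B - E)}"
  have K: "countable K"
    unfolding K_def using M(2) by simp
  have "\<Union>K \<in> sets borel"
    using K M(1) region_closed unfolding K_def by (intro sets.countable_Union) auto
  moreover have "meager C (E - \<Union>K)"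
  proof -
    have "meager C (B \<inter> E)" if "B \<in> M - K" for B
      using that M(1) unfolding K_def by blast
    then have "meager C ((\<Union>B\<in>M - K. B \<inter> E) \<union> - \<Union>M)"
      using M(2) singular_meager[OF M(3)] by (intro meager_Un meager_Union) auto
    then show ?thesis
      by (rule meager_subset) blast
  qed
  moreover have "meager C (\<Union>K - E)"
  proof -
    have "meager C (\<Union>B\<in>K. B - E)"
      using K unfolding K_def by (intro meager_Union) auto
    then show ?thesis
      by (rule meager_subset) blast
  qed
  ultimately show thesis
    by (rule that)
qed

text \<open>Every member of \<open>F\<close> is comeager in some region of a countable family
  \<open>M\<close>, and disjoint sets cannot both be comeager in one region; this injects
  \<open>F\<close> into \<open>M\<close>.\<close>

lemma ccc_disjoint_abundant_countable:
  assumes ccc: "ccc_base C" and F: "pairwise disjnt F"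
    "\<And>E. E \<in> F \<Longrightarrow> baire_set C E \<and> \<not> meager C E"
  shows "countable F"
proof -
  \<comment> \<open>The second alternative, that no member of \<open>F\<close> is comeager in any
    subregion, is there to make the family dense.\<close>
  let ?\<N> = "{B. region C B \<and> ((\<exists>E\<in>F. meager C (B - E)) \<or>
    (\<forall>E\<in>F. \<forall>R. region C R \<and> R \<subseteq> B \<longrightarrow> \<not> meager C (R - E)))}"
  obtain M where M: "M \<subseteq> ?\<N>" "countable M"
    "\<And>A. region C A \<Longrightarrow> \<exists>E\<in>M. \<exists>R. region C R \<and> R \<subseteq> A \<inter> E"
  proof (rule ccc_refinement[OF ccc, of ?\<N>])
    fix N B assume N: "N \<in> ?\<N>" and B: "region C B" "B \<subseteq> N"
    have "meager C (N - E) \<Longrightarrow> meager C (B - E)" for E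
      using B(2) by (elim meager_subset) blast
    then show "B \<in> ?\<N>"
      using N B by (blast dest: order_trans)
  next
    fix A assume A: "region C A"
    show "\<exists>N\<in>?\<N>. N \<subseteq> A"
    proof (cases "\<exists>E\<in>F. \<exists>R. region C R \<and> R \<subseteq> A \<and> meager C (R - E)")
      case True
      then show ?thesis
        by blast
    next
      case False
      then have "A \<in> ?\<N>"
        using A by simp
      then show ?thesis
        by blast
    qed
  qed blast+
  have only_one: "E = E'" if "E \<in> F" "E' \<in> F" "region C R" "meager C (R - E)" "meager C (R - E')"
    for E E' R
  proof (rule ccontr)
    assume "E \<noteq> E'"
    then have "E \<inter> E' = {}"
      using F(1) that(1,2) unfolding pairwise_def disjnt_def by blast
    then have "R \<subseteq> (R - E) \<union> (R - E')"
      by blast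
    then show False
      using that(3-5) region_abundant meager_Un meager_subset by metis
  qed
  have "\<exists>m\<in>M. meager C (m - E)" if E: "E \<in> F" for E
  proof -
    obtain B where B: "region C B" "meager C (B - E)"
      using abundant_baire_obtain_region F(2)[OF E] by blast
    obtain m R where m: "m \<in> M" "region C R" "R \<subseteq> B \<inter> m"
      using M(3)[OF B(1)] by blast
    have RE: "meager C (R - E)"
      using B(2) by (rule meager_subset) (use m in blast)
    \<comment> \<open>\<open>E\<close> is comeager in the subregion \<open>R\<close> of
      \<open>m\<close>, which rules out the second alternative for \<open>m\<close>.\<close>
    then obtain E' where E': "E' \<in> F" "meager C (m - E')"
      using M(1) m E by blast
    have "meager C (R - E')"
      using E'(2) by (rule meager_subset) (use m in blast)
    then show ?thesis
      using only_one[OF E E'(1) m(2) RE] E' m(1) by blast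
  qed
  then obtain h where h: "\<And>E. E \<in> F \<Longrightarrow> h E \<in> M \<and> meager C (h E - E)"
    by metis
  have "inj_on h F"
    using h M(1) only_one by (intro inj_onI) (metis (no_types, lifting) mem_Collect_eq subsetD)
  moreover have "countable (h ` F)"
    using h M(2) by (meson countable_subset image_subsetI)
  ultimately show ?thesis
    by (rule countable_image_inj_on[rotated])
qed

end

section \<open>Non-equivalent bases\<close>

text \<open>The witness is the saturation of a Borel cover \<open>G\<close> of \<open>S\<close>
  under a countable dense set. \<open>G\<close> being Borel is what carries over: Borel sets are
  Baire for \<open>D\<close> too, so the zero-one law applies there.\<close>

lemma meager_le_or_decomposition:
  assumes "CH_translation_base C" "CH_translation_base D" and ccc: "ccc_base C"
    and S: "meager C S" "\<not> meager D S"
  shows "\<exists>A. meager C A \<and> meager D (- A)"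
proof -
  interpret C: CH_translation_base C by fact
  interpret D: CH_translation_base D by fact
  obtain G where G: "G \<in> sets borel" "S \<subseteq> G" "meager C G"
    using C.ccc_meager_borel_cover[OF ccc S(1)] .
  have "\<not> meager D G"
    using S(2) G(2) meager_subset by blast
  obtain Q :: "'a set" where Q: "countable Q" "closure Q = UNIV"
    by (rule C.dense_exists)
  have "meager D (- (\<Union>r\<in>Q. (\<lambda>x. x + r) ` G))"
    using D.borel_baire[OF G(1)] \<open>\<not> meager D G\<close> Q by (rule D.saturation_comeager)
  moreover have "meager C (\<Union>r\<in>Q. (\<lambda>x. x + r) ` G)"
    using Q(1) C.meager_shift[OF G(3)] by (rule meager_Union)
  ultimately show ?thesis
    by blast
qed

text \<open>Regions of \<open>D\<close> are closed, hence Baire for \<open>C\<close>, and they are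
  \<open>C\<close>-abundant since they are \<open>D\<close>-abundant.\<close>

lemma ccc_base_transfer:
  assumes "CH_translation_base C" "CH_translation_base D" and ccc: "ccc_base C"
    and le: "\<And>S. meager C S \<Longrightarrow> meager D S"
  shows "ccc_base D"
proof -
  interpret C: CH_translation_base C by fact
  interpret D: CH_translation_base D by fact
  show ?thesis
    unfolding ccc_base_def
  proof (intro allI impI, elim conjE)
    fix F :: "'a set set" assume F: "\<forall>A\<in>F. region D A" "pairwise disjnt F"
    show "countable F"
      using ccc F(2)
    proof (rule C.ccc_disjoint_abundant_countable)
      fix E assume "E \<in> F"
      then have "region D E"
        using F(1) by blast
      then show "baire_set C E \<and> \<not> meager C E"
        using C.closed_baire D.region_closed D.region_abundant le by auto
    qed
  qed
qed

text \<open>Modulo \<open>C\<close>-meager sets, which are \<open>D\<close>-meager, \<open>E\<close>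
  is Borel and hence Baire for \<open>D\<close>.\<close>

lemma baire_set_transfer:
  assumes "CH_translation_base C" "CH_translation_base D" and ccc: "ccc_base C"
    and le: "\<And>S. meager C S \<Longrightarrow> meager D S" and E: "baire_set C E"
  shows "baire_set D E"
proof -
  interpret C: CH_translation_base C by fact
  interpret D: CH_translation_base D by fact
  obtain G where "G \<in> sets borel" "meager C (E - G)" "meager C (G - E)"
    using C.ccc_baire_borel_approximation[OF ccc E] .
  then show ?thesis
    using D.borel_baire D.baire_meager_Diff le by blast
qed

lemma nonequivalent_decomposition:
  assumes C: "CH_translation_base C" and D: "CH_translation_base D" and ccc: "ccc_base C"
    and ne: "\<not> equivalent_bases C D"
  obtains A where "meager C A" "meager D (- A)"
proof -
  have "\<exists>A. meager C A \<and> meager D (- A)"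
  proof (rule ccontr)
    assume no: "\<nexists>A. meager C A \<and> meager D (- A)"
    then have le: "meager D S" if "meager C S" for S
      using meager_le_or_decomposition[OF C D ccc that] by blast
    then have cccD: "ccc_base D"
      using ccc_base_transfer[OF C D ccc] by blast
    \<comment> \<open>A decomposition with the roles exchanged becomes one of the original kind by
      taking the complement.\<close>
    have ge: "meager C S" if "meager D S" for S
      using meager_le_or_decomposition[OF D C cccD that] no by (metis double_complement)
    have "baire_set C E \<longleftrightarrow> baire_set D E" for E
      using baire_set_transfer[OF C D ccc le] baire_set_transfer[OF D C cccD ge] by blast
    then show False
      using ne le ge unfolding equivalent_bases_def by blast
  qed
  then show thesis using that by blast
qed

section \<open>Rare sets with Bernstein sum\<close>

context CH_translation_base
begin

lemma meager_reflect:
  assumes lin: "linearly_invariant C" and S: "meager C S"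
  shows "meager C ((\<lambda>x. p - x) ` S)"
proof -
  have "(\<lambda>x. p - x) ` E \<in> C" if E: "E \<in> C" for E
  proof -
    have "(\<lambda>x. (-1) *\<^sub>R x) ` E \<in> C"
      using lin E unfolding linearly_invariant_def by (metis zero_neq_neg_one)
    then have "(\<lambda>x. x + p) ` (\<lambda>x. (-1) *\<^sub>R x) ` E \<in> C"
      using lin unfolding linearly_invariant_def translation_invariant_def by blast
    then show ?thesis
      unfolding image_image by simp
  qed
  then show ?thesis
    using S by (intro meager_image[where g = "\<lambda>x. p - x"]) auto
qed

text \<open>The Luzin set argument: \<open>N y\<close> can contain \<open>a x\<close> only for
  \<open>x\<close> equal to \<open>y\<close> or preceding it, which leaves countably many
  indices.\<close>

lemma rare_range:
  fixes a :: "real \<Rightarrow> 'a"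
  assumes W: "\<And>x y. x \<noteq> y \<Longrightarrow> (x, y) \<in> W \<or> (y, x) \<in> W" "\<And>x. countable {y. (y, x) \<in> W}"
    and cof: "\<And>S. singular C S \<Longrightarrow> \<exists>y. S \<subseteq> N y"
    and a: "\<And>x y. (y, x) \<in> W \<Longrightarrow> a x \<notin> N y" "\<And>x y. (y, x) \<in> W \<Longrightarrow> a x \<noteq> a y"
  shows "rare_set C (range a)"
  unfolding rare_set_def
proof (intro conjI allI impI)
  have "inj a"
    using W(1) a(2) by (metis injI)
  then show "uncountable (range a)"
    using countable_image_inj_on uncountable_UNIV_real by blast
next
  fix M assume "meager C M"
  then obtain F where F: "countable F" "\<And>S. S \<in> F \<Longrightarrow> singular C S" "M = \<Union>F"
    unfolding meager_def by blast
  have "countable (range a \<inter> S)" if "S \<in> F" for S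
  proof -
    obtain y where y: "S \<subseteq> N y"
      using cof F(2)[OF \<open>S \<in> F\<close>] by blast
    have "range a \<inter> S \<subseteq> a ` insert y {z. (z, y) \<in> W}"
      using y W(1) a(1) by blast
    then show ?thesis
      by (rule countable_subset) (simp add: W(2))
  qed
  then have "countable (\<Union>S\<in>F. range a \<inter> S)"
    using F(1) by blast
  moreover have "range a \<inter> M = (\<Union>S\<in>F. range a \<inter> S)"
    unfolding F(3) by blast
  ultimately show "countable (range a \<inter> M)"
    by simp
qed

lemma rare_summands_of_bernstein:
  assumes ccc: "ccc_base C" and lin: "linearly_invariant C"
  obtains T T' where "rare_set C T" "rare_set C T'" "bernstein_set {a + b | a b. a \<in> T \<and> b \<in> T'}"
proof -
  obtain W :: "real rel" where W: "wf W" "trans W" "\<And>x y. x \<noteq> y \<Longrightarrow> (x, y) \<in> W \<or> (y, x) \<in> W"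
    "\<And>x. countable {y. (y, x) \<in> W}"
    using CH_well_order[OF CH] by blast
  obtain g :: "real \<Rightarrow> 'a set" where g: "\<And>F. closed F \<Longrightarrow> \<exists>x. g x = F"
    using real_enumerates_closed_sets by metis
  \<comment> \<open>The default \<open>UNIV\<close> is itself perfect, so every stage has an
    uncountable target.\<close>
  define P where "P x = (if perfect_set (g x) \<and> g x \<noteq> {} then g x else UNIV)" for x
  have "perfect_set (UNIV :: 'a set)"
    using islimpt_UNIV unfolding perfect_set_def by simp
  then have "perfect_set (P x)" "P x \<noteq> {}" for x
    unfolding P_def by auto
  then have P: "uncountable (P x)" for x
    by (rule uncountable_perfect_set)
  have P_surj: "\<exists>x. P x = Z" if "perfect_set Z" "Z \<noteq> {}" for Z
    using g[of Z] that unfolding P_def by (metis perfect_set_def)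
  obtain G :: "real \<Rightarrow> nat \<Rightarrow> 'a set" where G: "\<And>F. (\<And>n. closed (F n)) \<Longrightarrow> \<exists>x. G x = F"
    using real_enumerates_closed_sequences by blast
  \<comment> \<open>The meager G-delta sets, padded with \<open>{}\<close>; by \<open>cof\<close>
    every singular set lies in one of them.\<close>
  define N where "N x = (if meager C (- (\<Union>n. G x n)) then - (\<Union>n. G x n) else {})" for x
  have N: "meager C (N x)" for x
    unfolding N_def by simp
  have cof: "\<exists>y. S \<subseteq> N y" if S: "singular C S" for S
  proof -
    obtain F :: "nat \<Rightarrow> 'a set" where F: "\<And>n. closed (F n)" "singular C (- (\<Union>n. F n))" "S \<subseteq> - (\<Union>n. F n)"
      using ccc_singular_cover[OF ccc S] by metis
    then obtain x where "G x = F"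
      using G by blast
    then have "S \<subseteq> N x"
      unfolding N_def using F(3) singular_meager[OF F(2)] by auto
    then show ?thesis ..
  qed
  define I where "I x = {y. (y, x) \<in> W}" for x
  \<comment> \<open>At stage \<open>x\<close> the summands \<open>t\<close> and \<open>t'\<close>
    put a point of \<open>P x\<close> into the sum and \<open>q\<close> is the point of
    \<open>P x\<close> left out. The other clauses secure rareness and keep old and new sums apart
    from old and new omitted points.\<close>
  define Q where "Q a b c x t t' q \<longleftrightarrow>
    q \<in> P x \<and> t + t' \<in> P x \<and> t + t' \<noteq> q \<and>
    (\<forall>y\<in>I x. t \<notin> N y \<and> t' \<notin> N y \<and> t \<noteq> a y \<and> t' \<noteq> b y \<and> t + t' \<noteq> c y \<and> t + b y \<noteq> q \<and> a y + t' \<noteq> q) \<and>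
    (\<forall>y\<in>I x. \<forall>z\<in>I x. a y + b z \<noteq> q \<and> t + b z \<noteq> c y \<and> a z + t' \<noteq> c y)"
    for a b c :: "real \<Rightarrow> 'a" and x t t' q
  have Q_cong: "Q a b c x = Q a' b' c' x"
    if "\<And>y. (y, x) \<in> W \<Longrightarrow> a y = a' y \<and> b y = b' y \<and> c y = c' y" for a b c a' b' c' x
    using that unfolding Q_def I_def by (intro ext) auto
  have Q_ex: "\<exists>t t' q. Q a b c x t t' q" for a b c x
  proof -
    have I: "countable (I x)"
      unfolding I_def by (rule W(4))
    have "countable (\<Union>y\<in>I x. \<Union>z\<in>I x. {a y + b z})"
      using I by (intro countable_UN) auto
    then have "\<not> P x \<subseteq> (\<Union>y\<in>I x. \<Union>z\<in>I x. {a y + b z})"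
      using P[of x] by (metis countable_subset)
    then obtain q where q: "q \<in> P x" "\<And>y z. y \<in> I x \<Longrightarrow> z \<in> I x \<Longrightarrow> a y + b z \<noteq> q"
      by blast
    \<comment> \<open>The point \<open>p\<close> to be represented must differ from all omitted
      points, old and new.\<close>
    have "countable (insert q (c ` I x))"
      using I by simp
    then have "\<not> P x \<subseteq> insert q (c ` I x)"
      using P[of x] by (metis countable_subset)
    then obtain p where p: "p \<in> P x" "p \<noteq> q" "\<And>y. y \<in> I x \<Longrightarrow> p \<noteq> c y"
      by blast
    let ?N = "\<Union>y\<in>I x. N y"
    \<comment> \<open>After substituting \<open>p - t\<close> for \<open>t'\<close>, each forbidden
      equation has a single solution \<open>t\<close>; \<open>?K\<close> collects these
      solutions.\<close>
    let ?K = "a ` I x \<union> (\<lambda>y. p - b y) ` I x \<union> (\<lambda>y. q - b y) ` I x \<union> (\<lambda>y. a y + p - q) ` I x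
      \<union> (\<Union>y\<in>I x. \<Union>z\<in>I x. {c y - b z, a z + p - c y})"
    have N': "meager C ?N"
      using I N by (rule meager_Union)
    have "meager C ?K"
      using I by (intro countable_meager countable_Un countable_UN countable_image) auto
    define Z where "Z = ?N \<union> (\<lambda>x. p - x) ` ?N \<union> ?K"
    have "meager C Z"
      unfolding Z_def using \<open>meager C ?K\<close>
      by (rule meager_Un[OF meager_Un[OF N' meager_reflect[OF lin N']]])
    moreover have "\<not> meager C UNIV"
      using region_abundant point_in_region meager_subset by (metis subset_UNIV)
    ultimately obtain t where "t \<notin> Z"
      by (metis UNIV_eq_I)
    then have t: "t \<notin> ?N" "t \<notin> (\<lambda>x. p - x) ` ?N" "t \<notin> ?K"
      unfolding Z_def by (simp_all only: Un_iff not_False_eq_True de_Morgan_disj)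
    have "Q a b c x t (p - t) q"
      unfolding Q_def
    proof (intro conjI ballI)
      show "q \<in> P x" "t + (p - t) \<in> P x" "t + (p - t) \<noteq> q"
        using q p by auto
      fix y assume y: "y \<in> I x"
      show "t \<notin> N y" "t \<noteq> a y" "t + (p - t) \<noteq> c y"
        using t y p(3) by auto
      have "t = p - (p - t)"
        by simp
      then show "p - t \<notin> N y"
        using t(2) y by blast
      show "p - t \<noteq> b y" "t + b y \<noteq> q"
        using t(3) y by (auto simp: algebra_simps)
      have "t \<noteq> a y + p - q"
        using t(3) y by blast
      then show "a y + (p - t) \<noteq> q"
        by (auto simp: algebra_simps)
      fix z assume z: "z \<in> I x"
      show "a y + b z \<noteq> q"
        using q(2) y z .
      have "t \<noteq> c y - b z" "t \<noteq> a z + p - c y"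
        using t(3) y z by blast+
      then show "t + b z \<noteq> c y" "a z + (p - t) \<noteq> c y"
        by (auto simp: algebra_simps)
    qed
    then show ?thesis by blast
  qed
  have "\<exists>f. \<forall>x. Q (\<lambda>y. fst (f y)) (\<lambda>y. fst (snd (f y))) (\<lambda>y. snd (snd (f y))) x
      (fst (f x)) (fst (snd (f x))) (snd (snd (f x)))"
  proof (rule dependent_wf_choice[OF W(1), where P = "\<lambda>f x r.
      Q (\<lambda>y. fst (f y)) (\<lambda>y. fst (snd (f y))) (\<lambda>y. snd (snd (f y))) x (fst r) (fst (snd r)) (snd (snd r))"])
    fix f h :: "real \<Rightarrow> 'a \<times> 'a \<times> 'a" and x and r :: "'a \<times> 'a \<times> 'a"
    assume eq: "\<And>z. (z, x) \<in> W \<Longrightarrow> f z = h z"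
    have "Q (\<lambda>y. fst (f y)) (\<lambda>y. fst (snd (f y))) (\<lambda>y. snd (snd (f y))) x =
      Q (\<lambda>y. fst (h y)) (\<lambda>y. fst (snd (h y))) (\<lambda>y. snd (snd (h y))) x"
      by (rule Q_cong) (simp add: eq)
    then show "Q (\<lambda>y. fst (f y)) (\<lambda>y. fst (snd (f y))) (\<lambda>y. snd (snd (f y))) x
        (fst r) (fst (snd r)) (snd (snd r)) =
      Q (\<lambda>y. fst (h y)) (\<lambda>y. fst (snd (h y))) (\<lambda>y. snd (snd (h y))) x
        (fst r) (fst (snd r)) (snd (snd r))"
      by (simp only:)
  next
    fix x and f :: "real \<Rightarrow> 'a \<times> 'a \<times> 'a"
    obtain t t' q where "Q (\<lambda>y. fst (f y)) (\<lambda>y. fst (snd (f y))) (\<lambda>y. snd (snd (f y))) x t t' q"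
      using Q_ex by blast
    then show "\<exists>r. Q (\<lambda>y. fst (f y)) (\<lambda>y. fst (snd (f y))) (\<lambda>y. snd (snd (f y))) x
        (fst r) (fst (snd r)) (snd (snd r))"
      by (intro exI[of _ "(t, t', q)"]) simp
  qed
  then obtain a b c where abc: "\<And>x. Q a b c x (a x) (b x) (c x)"
    by blast
  have "rare_set C (range a)" "rare_set C (range b)"
    by (rule rare_range[OF W(3,4) cof]; use abc in \<open>auto simp: Q_def I_def\<close>)+
  moreover have c: "c x \<noteq> a y + b z" for x y z
  proof -
    \<comment> \<open>The clauses of \<open>Q\<close> at the latest of the three stages exclude the
      equation, whichever indices coincide with it.\<close>
    have "\<exists>m\<in>{x, y, z}. \<forall>w\<in>{x, y, z}. w = m \<or> w \<in> I m"
      using W(3)[of x y] W(3)[of y z] W(3)[of x z] W(2) unfolding I_def trans_def by blast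
    then obtain m where m: "m = x \<or> m = y \<or> m = z"
      "x = m \<or> x \<in> I m" "y = m \<or> y \<in> I m" "z = m \<or> z \<in> I m"
      by auto
    have "a m + b m \<noteq> c m"
      "\<And>y. y \<in> I m \<Longrightarrow> a m + b m \<noteq> c y \<and> a m + b y \<noteq> c m \<and> a y + b m \<noteq> c m"
      "\<And>y z. y \<in> I m \<Longrightarrow> z \<in> I m \<Longrightarrow> a y + b z \<noteq> c m \<and> a m + b z \<noteq> c y \<and> a z + b m \<noteq> c y"
      using abc[of m] unfolding Q_def by auto
    then show ?thesis
      using m by metis
  qed
  have "bernstein_set {u + v | u v. u \<in> range a \<and> v \<in> range b}"
    unfolding bernstein_set_def
  proof (intro allI impI, elim conjE)
    fix Z :: "'a set" assume "Z \<noteq> {}" "perfect_set Z"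
    then obtain x where x: "P x = Z"
      using P_surj by blast
    then have "a x + b x \<in> Z" "c x \<in> Z"
      using abc[of x] unfolding Q_def by auto
    moreover have "c x \<notin> {u + v | u v. u \<in> range a \<and> v \<in> range b}"
      using c by blast
    ultimately show "{u + v | u v. u \<in> range a \<and> v \<in> range b} \<inter> Z \<noteq> {} \<and>
        (UNIV - {u + v | u v. u \<in> range a \<and> v \<in> range b}) \<inter> Z \<noteq> {}"
      by blast
  qed
  ultimately show thesis
    by (rule that)
qed

end

theorem theorem2p10:
  fixes C :: "'a::{polish_space, real_vector} set set"
  assumes CH: "continuum_hypothesis"
    and add_cont: "continuous_on UNIV (\<lambda>(x::'a, y::'a). x + y)"
    and scale_cont: "continuous_on UNIV (\<lambda>(c::real, x::'a). c *\<^sub>R x)"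
    and ptb: "perfect_translation_base C"
    and ccc: "ccc_base C"
    and lin: "linearly_invariant C"
    and card: "C \<lesssim> (UNIV :: real set)"
  shows "\<exists>T T' :: 'a set.
           rare_set C T \<and> rare_set C T' \<and>
           bernstein_set {a + b | a b. a \<in> T \<and> b \<in> T'} \<and>
           (\<forall>D :: 'a set set. perfect_translation_base D \<and> \<not> equivalent_bases C D \<longrightarrow>
               meager D T \<and> meager D T')"
proof -
  have base: "CH_translation_base D" if "perfect_translation_base D" for D :: "'a set set"
    by (rule CH_translation_base.intro[OF CH add_cont scale_cont that])
  have rare: "meager D R"
    if R: "rare_set C R" and D: "perfect_translation_base D" "\<not> equivalent_bases C D"
    for D and R :: "'a set"
  proof -
    obtain A where A: "meager C A" "meager D (- A)"
      using nonequivalent_decomposition[OF base[OF ptb] base[OF D(1)] ccc D(2)] .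
    \<comment> \<open>Rareness makes this set countable, and singletons are singular for
      \<open>D\<close>; the rest of \<open>R\<close> lies in \<open>- A\<close>.\<close>
    have "meager D (R \<inter> A)"
      using R A(1) CH_translation_base.countable_meager[OF base[OF D(1)]] unfolding rare_set_def
      by blast
    then have "meager D ((R \<inter> A) \<union> - A)"
      using A(2) by (rule meager_Un)
    then show ?thesis
      by (rule meager_subset) blast
  qed
  obtain T T' where "rare_set C T" "rare_set C T'"
    "bernstein_set {a + b | a b. a \<in> T \<and> b \<in> T'}"
    using CH_translation_base.rare_summands_of_bernstein[OF base[OF ptb] ccc lin] .
  then show ?thesis
    using rare by blast
qed

end
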